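(* Let $G=(V,E)$ be a finite connected undirected graph with edge rates $\eta_{\{u,v\}}>0$ and heat bath rates $\xi_v\ge 0$ ($v\in V$) with $\sum_{v\in V}\xi_v>0$. Let $(h_v)_{v\in V}$ and $(h'_v)_{v\in V}$ be two arbitrary families of probability distributions on $\{0,1\}$, and let $\mathcal{Q}=\mathcal{S}+\mathcal{H}$ and $\mathcal{Q}'=\mathcal{S}+\mathcal{H}'$ be the rate matrices of the SEPs with these rates and with heat baths $(h_v)$ and $(h'_v)$ respectively. Then $\operatorname{spec}(\mathcal{Q}')=\operatorname{spec}(\mathcal{Q})$, where $\operatorname{spec}$ denotes the multiset of eigenvalues of a matrix.
   Context: All matrices act on the space with basis $\{0,1\}^V$ (rows and columns indexed by configurations; row index = state before, column index = state after). $S$ is the $\{0,1\}^2\times\{0,1\}^2$ exchange matrix: $S_{a,b}^{c,d}=1$ if $a=d$ and $b=c$, and $0$ otherwise (subscript = row, superscript = column); $S(\{u,v\})$ is $S$ applied at the two vertices $u,v$. The internal dynamics matrix is $$\mathcal{S}=\sum_{\{u,v\}\in E}\eta_{\{u,v\}}\; S(\{u,v\})\otimes I(V\setminus\{u,v\}),$$ where $I(W)$ is the identity on the factors in $W$. For $v\in V$, $H(v)=\mathbb{1}\cdot h_v$ is the $\{0,1\}\times\{0,1\}$ rank-one matrix given by the product of the all-ones column vector $\mathbb{1}$ and the row vector $h_v=(h_v(0),h_v(1))$ with $h_v(0)+h_v(1)=1$ and $h_v(0),h_v(1)\ge 0$. The heat bath matrix is $$\mathcal{H}=\sum_{v\in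 V}\xi_v\; H(v)\otimes I(V\setminus\{v\}),$$ and $\mathcal{H}'$ is defined in the same way from $H'(v)=\mathbb{1}\cdot h'_v$. (Vertices without a heat bath are those with $\xi_v=0$.) *)

theory Defs
  imports "HOL-Analysis.Analysis" "HOL-Computational_Algebra.Fundamental_Theorem_Algebra"
begin

definition charpoly :: "'a::comm_ring_1^'n^'n \<Rightarrow> 'a poly" where
  "charpoly A = det (mat [:0, 1:] - map_matrix (\<lambda>a. [:a:]) A)"

text \<open>Eigenvalues are taken in the complex numbers and counted with algebraic multiplicity.\<close>

definition spec :: "real^'n^'n \<Rightarrow> complex multiset" where
  "spec A = proots (charpoly (map_matrix complex_of_real A))"

lemma poly_charpoly: "poly (charpoly A) z = det (mat z - A)"
proof -
  define M where "M = mat [:0, 1:] - map_matrix (\<lambda>a. [:a:]) A"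
  have entry: "poly (M $ i $ j) z = (mat z - A) $ i $ j" for i j
    by (simp add: M_def mat_def)
  show ?thesis
    unfolding charpoly_def M_def[symmetric] det_def
    by (simp only: poly_sum poly_mult poly_prod poly_of_int entry)
qed

lemma charpoly_monic:
  fixes A :: "'a::idom^'n^'n"
  shows degree_charpoly: "degree (charpoly A) = CARD('n)"
    and lead_coeff_charpoly: "lead_coeff (charpoly A) = 1"
proof -
  define M where "M = mat [:0, 1:] - map_matrix (\<lambda>a. [:a:]) A"
  have M: "M $ i $ j = (if i = j then [:- A $ i $ j, 1:] else [:- A $ i $ j:])" for i j
    by (simp add: M_def mat_def)
  let ?P = "{p. p permutes (UNIV :: 'n set)}"
  let ?t = "\<lambda>p. of_int (sign p) * (\<Prod>i\<in>UNIV. M $ i $ p i)"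
  have t_id: "?t id = (\<Prod>i\<in>UNIV. [:- A $ i $ i, 1:])"
    by (simp add: M)
  have id: "degree (?t id) = CARD('n)" "lead_coeff (?t id) = 1"
    unfolding t_id lead_coeff_prod by (simp_all add: degree_prod_sum_eq)
  have small: "degree (?t p) < CARD('n)" if "p \<in> ?P - {id}" for p
  proof -
    from that obtain k where k: "p k \<noteq> k" by fastforce
    have "degree (?t p) \<le> degree (\<Prod>i\<in>UNIV. M $ i $ p i)"
      by (cases "sign p = 1") (auto simp: sign_def)
    also have "\<dots> \<le> (\<Sum>i\<in>UNIV. degree (M $ i $ p i))"
      using degree_prod_sum_le[of UNIV "\<lambda>i. M $ i $ p i"] by (simp add: o_def)
    also have "\<dots> < (\<Sum>i\<in>(UNIV :: 'n set). 1)"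
      by (rule sum_strict_mono_ex1) (use k in \<open>auto simp: M intro!: exI[of _ k]\<close>)
    finally show ?thesis by simp
  qed
  have "degree (\<Sum>p\<in>?P - {id}. ?t p) < CARD('n)"
    by (rule degree_sum_less) (use small in auto)
  moreover have "charpoly A = ?t id + (\<Sum>p\<in>?P - {id}. ?t p)"
    unfolding charpoly_def M_def[symmetric] det_def
    by (subst sum.remove[of _ id]) (auto simp: permutes_id)
  ultimately show "degree (charpoly A) = CARD('n)" "lead_coeff (charpoly A) = 1"
    using id by (simp_all add: degree_add_eq_left coeff_eq_0)
qed

lemma size_spec: "size (spec (A :: real^'n^'n)) = CARD('n)"
  by (simp add: spec_def size_proots_complex degree_charpoly)

lemma set_mset_spec:
  "set_mset (spec A) = {z. \<exists>x. x \<noteq> 0 \<and> map_matrix complex_of_real A *v x = z *s x}"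
proof -
  define B where "B = map_matrix complex_of_real A"
  have "charpoly B \<noteq> 0"
    using lead_coeff_charpoly[of B] by auto
  moreover have "det (mat z - B) = 0 \<longleftrightarrow> (\<exists>x. x \<noteq> 0 \<and> B *v x = z *s x)" for z
  proof -
    have "det (mat z - B) = 0 \<longleftrightarrow> (\<exists>x. x \<noteq> 0 \<and> (mat z - B) *v x = 0)"
      using invertible_det_nz[of "mat z - B"] matrix_left_invertible_ker[of "mat z - B"]
        invertible_left_inverse[of "mat z - B"] by blast
    moreover have "(mat z - B) *v x = z *s x - B *v x" for x
      by (simp add: vec_eq_iff matrix_vector_mult_def mat_def left_diff_distrib sum_subtractf
          if_distrib[of "\<lambda>c. c * _"] cong: if_cong)
    ultimately show ?thesis by (simp add: eq_commute[of "z *s _"])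
  qed
  ultimately show ?thesis
    by (simp add: spec_def B_def[symmetric] poly_charpoly)
qed

text \<open>
  Configurations are functions \<open>'v \<Rightarrow> bool\<close> (\<open>False\<close> for 0, \<open>True\<close> for 1).  In
  \<open>M $ \<sigma> $ \<tau>\<close> the row index \<open>\<sigma>\<close> is the state before and the column index \<open>\<tau>\<close>
  the state after a transition.
\<close>

type_synonym 'v config_mat = "real^('v \<Rightarrow> bool)^('v \<Rightarrow> bool)"

definition id_entry :: "'v set \<Rightarrow> ('v \<Rightarrow> bool) \<Rightarrow> ('v \<Rightarrow> bool) \<Rightarrow> real" where
  "id_entry W \<sigma> \<tau> = (if \<forall>w\<in>W. \<sigma> w = \<tau> w then 1 else 0)"

definition exch :: "real^(bool \<times> bool)^(bool \<times> bool)" where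
  "exch = (\<chi> ab cd. case (ab, cd) of ((a, b), (c, d)) \<Rightarrow> if a = d \<and> b = c then 1 else 0)"

definition exch_pair :: "'v::finite \<Rightarrow> 'v \<Rightarrow> 'v config_mat" where
  "exch_pair u v =
     (\<chi> \<sigma> \<tau>. exch $ (\<sigma> u, \<sigma> v) $ (\<tau> u, \<tau> v) * id_entry (UNIV - {u, v}) \<sigma> \<tau>)"

text \<open>The operator attached to an unordered pair is well defined by symmetry;
  see \<open>exch_edge_eq\<close>.\<close>

definition exch_edge :: "'v::finite set \<Rightarrow> 'v config_mat" where
  "exch_edge e = (THE M. \<exists>u v. e = {u, v} \<and> M = exch_pair u v)"

lemma exch_pair_commute: "exch_pair u v = exch_pair v u"
  by (auto simp: exch_pair_def exch_def vec_eq_iff insert_commute)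

lemma exch_edge_eq: "exch_edge {u, v} = exch_pair u v"
  unfolding exch_edge_def
  by (rule the_equality) (auto simp: doubleton_eq_iff exch_pair_commute)

definition internal_matrix :: "'v::finite set set \<Rightarrow> ('v set \<Rightarrow> real) \<Rightarrow> 'v config_mat" where
  "internal_matrix E \<eta> = (\<Sum>e\<in>E. \<eta> e *\<^sub>R exch_edge e)"

definition bath_site :: "(bool \<Rightarrow> real) \<Rightarrow> real^bool^bool" where
  "bath_site p = (columnvector (\<chi> a. 1) :: real^1^bool) ** rowvector (\<chi> b. p b)"

definition bath_vertex :: "'v::finite \<Rightarrow> (bool \<Rightarrow> real) \<Rightarrow> 'v config_mat" where
  "bath_vertex v p = (\<chi> \<sigma> \<tau>. bath_site p $ \<sigma> v $ \<tau> v * id_entry (UNIV - {v}) \<sigma> \<tau>)"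

definition heat_bath_matrix :: "('v::finite \<Rightarrow> real) \<Rightarrow> ('v \<Rightarrow> bool \<Rightarrow> real) \<Rightarrow> 'v config_mat" where
  "heat_bath_matrix \<xi> h = (\<Sum>v\<in>UNIV. \<xi> v *\<^sub>R bath_vertex v (h v))"

definition sep_matrix ::
  "'v::finite set set \<Rightarrow> ('v set \<Rightarrow> real) \<Rightarrow> ('v \<Rightarrow> real) \<Rightarrow> ('v \<Rightarrow> bool \<Rightarrow> real) \<Rightarrow> 'v config_mat" where
  "sep_matrix E \<eta> \<xi> h = internal_matrix E \<eta> + heat_bath_matrix \<xi> h"

text \<open>Graphs have vertex set \<open>UNIV :: 'v set\<close> and a set of two-element edges.\<close>

definition simple_graph :: "'v set set \<Rightarrow> bool" where
  "simple_graph E \<longleftrightarrow> (\<forall>e\<in>E. card e = 2)"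

definition connected_graph :: "'v set set \<Rightarrow> bool" where
  "connected_graph E \<longleftrightarrow> (\<forall>u v. (u, v) \<in> {(x, y). {x, y} \<in> E}\<^sup>*)"

definition distribution01 :: "(bool \<Rightarrow> real) \<Rightarrow> bool" where
  "distribution01 p \<longleftrightarrow> p False \<ge> 0 \<and> p True \<ge> 0 \<and> p False + p True = 1"

end

theory Submission
  imports Defs
begin

text \<open>
  Let \<open>T\<close> be the tensor power of the \<open>2 \<times> 2\<close> matrix with columns \<open>(1, 1)\<close> and \<open>(0, 1)\<close>.  Exchanges
  commute with tensor powers, and a heat bath \<open>\<one> \<cdot> h\<close> becomes the upper triangular matrix with rows
  \<open>(1, h(1))\<close> and \<open>(0, 0)\<close> in this basis.  Conjugating the rate matrix with \<open>T\<close> therefore gives a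
  matrix that is block triangular with respect to the number of particles, and the distributions
  \<open>h\<^sub>v\<close> occur only in the blocks off the diagonal.
\<close>

text \<open>A permutation \<open>p\<close> contributes to the Leibniz expansion only if it never
  lowers \<open>N\<close>. As it also preserves the sum of \<open>N\<close>, it then preserves
  \<open>N\<close> pointwise, so every factor of its product lies in a diagonal block, where the
  matrices agree.\<close>

lemma det_graded_triangular_cong:
  fixes A B :: "'a::comm_ring_1^'n^'n" and N :: "'n \<Rightarrow> nat"
  assumes zero: "\<And>i j. N i > N j \<Longrightarrow> A $ i $ j = 0" "\<And>i j. N i > N j \<Longrightarrow> B $ i $ j = 0"
    and eq: "\<And>i j. N i = N j \<Longrightarrow> A $ i $ j = B $ i $ j"
  shows "det A = det B"
proof -
  have "(\<Prod>i\<in>UNIV. A $ i $ p i) = (\<Prod>i\<in>UNIV. B $ i $ p i)" if p: "p permutes UNIV" for p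
  proof (cases "\<forall>i. N i \<le> N (p i)")
    case True
    have "(\<Sum>i\<in>UNIV. N (p i)) = (\<Sum>i\<in>UNIV. N i)"
      using sum.permute[OF p, of N] by (simp add: o_def)
    \<comment> \<open>A termwise inequality between equal finite sums is a termwise
      equality.\<close>
    then have "N i = N (p i)" for i
      using sum_mono_inv[of N UNIV "\<lambda>i. N (p i)"] True by simp
    then show ?thesis
      using eq by (intro prod.cong) auto
  next
    case False
    then obtain i where "N i > N (p i)"
      by (auto simp: not_le)
    then have "A $ i $ p i = 0" "B $ i $ p i = 0"
      using zero by auto
    then show ?thesis
      by (metis (no_types, lifting) UNIV_I finite prod_zero)
  qed
  then show ?thesis
    unfolding det_def by (intro sum.cong) auto
qed

lemma map_matrix_of_real_mult:
  fixes A B :: "real^'n^'n"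
  shows "map_matrix complex_of_real (A ** B) =
    map_matrix complex_of_real A ** map_matrix complex_of_real B"
  by (simp add: vec_eq_iff matrix_matrix_mult_def)

lemma det_map_matrix_of_real:
  fixes A :: "real^'n^'n"
  shows "det (map_matrix complex_of_real A) = complex_of_real (det A)"
  by (simp add: det_def)

text \<open>Similarity is phrased as intertwining, so that no inverse of \<open>T\<close> appears:
  the relation passes to \<open>mat z - A\<close> and \<open>mat z - B\<close>, and the factor
  \<open>det T\<close> cancels after taking determinants.\<close>

lemma spec_similar:
  fixes A B T :: "real^'n^'n"
  assumes "A ** T = T ** B" and "det T \<noteq> 0"
  shows "spec A = spec B"
proof -
  define c where "c = (map_matrix complex_of_real :: real^'n^'n \<Rightarrow> _)"
  have "det (mat z - c A) = det (mat z - c B)" for z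
  proof -
    have "c A ** c T = c T ** c B"
      unfolding c_def map_matrix_of_real_mult[symmetric] assms(1) ..
    moreover have "mat z ** c T = c T ** mat z"
      by (simp add: vec_eq_iff matrix_matrix_mult_def mat_def
          if_distrib[of "\<lambda>x. x * _"] if_distrib[of "\<lambda>x. _ * x"] cong: if_cong)
    ultimately have "(mat z - c A) ** c T = c T ** (mat z - c B)"
      by (simp add: vec_eq_iff matrix_matrix_mult_def left_diff_distrib right_diff_distrib
          sum_subtractf)
    then have "det (mat z - c A) * det (c T) = det (c T) * det (mat z - c B)"
      by (metis det_mul)
    moreover have "det (c T) \<noteq> 0"
      using assms(2) by (simp add: c_def det_map_matrix_of_real)
    ultimately show ?thesis
      by simp
  qed
  \<comment> \<open>Polynomials over the infinite field of complex numbers that agree at every point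
    are equal.\<close>
  then have "charpoly (c A) = charpoly (c B)"
    by (intro iffD1[OF poly_eq_poly_eq_iff]) (simp add: fun_eq_iff poly_charpoly)
  then show ?thesis
    by (simp add: spec_def c_def)
qed

lemma spec_graded_triangular_cong:
  fixes A B :: "real^'n^'n" and N :: "'n \<Rightarrow> nat"
  assumes "\<And>i j. N i > N j \<Longrightarrow> A $ i $ j = 0" "\<And>i j. N i > N j \<Longrightarrow> B $ i $ j = 0"
    and "\<And>i j. N i = N j \<Longrightarrow> A $ i $ j = B $ i $ j"
  shows "spec A = spec B"
proof -
  have "charpoly (map_matrix complex_of_real A) = charpoly (map_matrix complex_of_real B)"
    \<comment> \<open>The determinant lemma is applied over the polynomial ring. The indeterminate
      sits on the diagonal only, hence inside the diagonal blocks.\<close>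
    unfolding charpoly_def
    by (rule det_graded_triangular_cong[of N]) (use assms in \<open>auto simp: mat_def\<close>)
  then show ?thesis
    by (simp add: spec_def)
qed

text \<open>This is the tensor power \<open>T\<close> of the introduction, since the product over
  all sites of the indicators of \<open>\<tau> w \<le> \<sigma> w\<close> is the indicator of
  \<open>\<tau> \<le> \<sigma>\<close>. It is the zeta matrix of the Boolean lattice.\<close>

definition zeta_matrix :: "'v::finite config_mat" where
  "zeta_matrix = (\<chi> \<sigma> \<tau>. if \<tau> \<le> \<sigma> then 1 else 0)"

text \<open>The matrix with rows \<open>(1, p True)\<close> and \<open>(0, 0)\<close> at site
  \<open>v\<close>, tensored with the identity elsewhere. Read by columns, it deletes a particle at
  \<open>v\<close> with weight \<open>p True\<close>.\<close>

definition bath_dual :: "'v::finite \<Rightarrow> (bool \<Rightarrow> real) \<Rightarrow> 'v config_mat" where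
  "bath_dual v p = (\<chi> \<rho> \<tau>.
     if \<tau> v then (if \<rho> = \<tau>(v := False) then p True else 0) else (if \<rho> = \<tau> then 1 else 0))"

definition sep_dual ::
  "'v::finite set set \<Rightarrow> ('v set \<Rightarrow> real) \<Rightarrow> ('v \<Rightarrow> real) \<Rightarrow> ('v \<Rightarrow> bool \<Rightarrow> real) \<Rightarrow> 'v config_mat" where
  "sep_dual E \<eta> \<xi> h = internal_matrix E \<eta> + (\<Sum>v\<in>UNIV. \<xi> v *\<^sub>R bath_dual v (h v))"

lemma det_zeta_matrix: "det (zeta_matrix :: 'v::finite config_mat) = 1"
proof -
  have card_le: "card (Collect \<tau>) \<le> card (Collect \<sigma>)" if "\<tau> \<le> \<sigma>" for \<sigma> \<tau> :: "'v \<Rightarrow> bool"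
    by (rule card_mono) (use that in auto)
  have eq: "\<tau> = \<sigma>" if "\<tau> \<le> \<sigma>" "card (Collect \<tau>) = card (Collect \<sigma>)" for \<sigma> \<tau> :: "'v \<Rightarrow> bool"
    using card_subset_eq[of "Collect \<sigma>" "Collect \<tau>"] that by auto
  \<comment> \<open>Transposing moves the nonzero entries to where the row has at most as many
    particles as the column, as the grading lemma demands. Comparable configurations with equally
    many particles coincide, so the diagonal blocks are identities.\<close>
  have "det (transpose (zeta_matrix :: 'v config_mat)) = det (mat 1 :: 'v config_mat)"
    by (rule det_graded_triangular_cong[of "\<lambda>\<sigma>. card (Collect \<sigma>)"])
      (auto simp: zeta_matrix_def transpose_def mat_def dest: card_le eq)
  then show ?thesis
    by (simp add: det_transpose)
qed

lemma exch_pair_nth: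
  assumes "u \<noteq> v"
  shows "exch_pair u v $ \<sigma> $ \<tau> = (if \<tau> = \<sigma> \<circ> Transposition.transpose u v then 1 else 0)"
proof -
  have "(\<sigma> u = \<tau> v \<and> \<sigma> v = \<tau> u \<and> (\<forall>w\<in>UNIV - {u, v}. \<sigma> w = \<tau> w)) \<longleftrightarrow>
    \<tau> = \<sigma> \<circ> Transposition.transpose u v"
  proof
    assume L: "\<sigma> u = \<tau> v \<and> \<sigma> v = \<tau> u \<and> (\<forall>w\<in>UNIV - {u, v}. \<sigma> w = \<tau> w)"
    show "\<tau> = \<sigma> \<circ> Transposition.transpose u v"
    proof
      fix w
      show "\<tau> w = (\<sigma> \<circ> Transposition.transpose u v) w"
        using L by (cases "w = u"; cases "w = v") simp_all
    qed
  qed (use assms in simp)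
  then show ?thesis
    by (auto simp: exch_pair_def exch_def id_entry_def)
qed

text \<open>Relabelling the sites by an involution preserves the order, so the transposition can be
  moved from one side of \<open>\<tau> \<le> \<sigma>\<close> to the other.\<close>

lemma exch_pair_zeta:
  fixes u v :: "'v::finite"
  assumes "u \<noteq> v"
  shows "exch_pair u v ** zeta_matrix = zeta_matrix ** exch_pair u v"
proof -
  let ?s = "Transposition.transpose u v"
  have swap: "\<tau> = \<rho> \<circ> ?s \<longleftrightarrow> \<rho> = \<tau> \<circ> ?s" for \<rho> \<tau> :: "'v \<Rightarrow> bool"
    by (auto simp: comp_assoc)
  have le: "\<tau> \<le> \<sigma> \<circ> ?s \<longleftrightarrow> \<tau> \<circ> ?s \<le> \<sigma>" for \<sigma> \<tau> :: "'v \<Rightarrow> bool"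
    unfolding le_fun_def o_def by (metis transpose_involutory)
  have "(exch_pair u v ** zeta_matrix) $ \<sigma> $ \<tau> = zeta_matrix $ (\<sigma> \<circ> ?s) $ \<tau>" for \<sigma> \<tau>
    by (simp add: matrix_matrix_mult_def exch_pair_nth[OF assms]
        if_distrib[of "\<lambda>x. x * _"] cong: if_cong)
  moreover have "(zeta_matrix ** exch_pair u v) $ \<sigma> $ \<tau> = zeta_matrix $ \<sigma> $ (\<tau> \<circ> ?s)" for \<sigma> \<tau>
    by (simp add: matrix_matrix_mult_def exch_pair_nth[OF assms] swap[of \<tau>]
        if_distrib[of "\<lambda>x. _ * x"] cong: if_cong)
  ultimately show ?thesis
    by (simp add: vec_eq_iff zeta_matrix_def le)
qed

lemma bath_vertex_nth:
  "bath_vertex v p $ \<sigma> $ \<tau> =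
     (if \<tau> = \<sigma>(v := True) then p True else 0) + (if \<tau> = \<sigma>(v := False) then p False else 0)"
proof -
  have "(\<forall>w\<in>UNIV - {v}. \<sigma> w = \<tau> w) \<longleftrightarrow> \<tau> = \<sigma>(v := \<tau> v)"
    by (auto simp: fun_eq_iff)
  moreover have "bath_site p $ a $ b = p b" for a b
    by (simp add: bath_site_def matrix_matrix_mult_def columnvector_def rowvector_def)
  ultimately show ?thesis
    by (cases "\<tau> v") (auto simp: bath_vertex_def id_entry_def fun_eq_iff)
qed

text \<open>If \<open>\<tau> v\<close> holds, only the outcome \<open>True\<close> can dominate
  \<open>\<tau>\<close>, and \<open>\<tau>(v := False) \<le> \<sigma>\<close> remains with weight
  \<open>p True\<close>. Otherwise both outcomes leave the condition
  \<open>\<tau> \<le> \<sigma>\<close>, and the weights sum to 1.\<close>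

lemma bath_vertex_zeta:
  assumes "distribution01 p"
  shows "bath_vertex v p ** zeta_matrix = zeta_matrix ** bath_dual v p"
proof -
  have le: "\<tau> \<le> \<sigma>(v := True) \<longleftrightarrow> \<tau>(v := False) \<le> \<sigma>"
    "\<tau> \<le> \<sigma>(v := False) \<longleftrightarrow> \<not> \<tau> v \<and> \<tau> \<le> \<sigma>" for \<sigma> \<tau> :: "'a \<Rightarrow> bool"
    by (auto simp: le_fun_def)
  have upd: "\<tau>(v := False) = \<tau>" if "\<not> \<tau> v" for \<tau> :: "'a \<Rightarrow> bool"
    using that by (simp add: fun_upd_idem)
  have "(bath_vertex v p ** zeta_matrix) $ \<sigma> $ \<tau> =
      p True * zeta_matrix $ (\<sigma>(v := True)) $ \<tau> + p False * zeta_matrix $ (\<sigma>(v := False)) $ \<tau>"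
    for \<sigma> \<tau>
    by (simp add: matrix_matrix_mult_def bath_vertex_nth distrib_right sum.distrib
        if_distrib[of "\<lambda>x. x * _"] cong: if_cong)
  moreover have "(zeta_matrix ** bath_dual v p) $ \<sigma> $ \<tau> =
      (if \<tau> v then p True * zeta_matrix $ \<sigma> $ (\<tau>(v := False)) else zeta_matrix $ \<sigma> $ \<tau>)" for \<sigma> \<tau>
    by (simp add: matrix_matrix_mult_def bath_dual_def
        if_distrib[of "\<lambda>x. _ * x"] cong: if_cong)
  ultimately show ?thesis
    using assms by (auto simp: vec_eq_iff zeta_matrix_def distribution01_def le upd)
qed

lemma exch_edge_obtain:
  assumes "simple_graph E" "e \<in> E"
  obtains u v where "u \<noteq> v" "exch_edge e = exch_pair u v"
  using assms by (metis simple_graph_def card_2_iff exch_edge_eq)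

lemma matrix_add_rdistrib:
  fixes A B :: "'a::semiring_1^'n^'m" and C :: "'a^'p^'n"
  shows "(A + B) ** C = A ** C + B ** C"
  by (simp add: vec_eq_iff matrix_matrix_mult_def distrib_right sum.distrib)

lemma matrix_sum_scaleR_intertwine:
  fixes A B :: "'i \<Rightarrow> real^'n^'n" and T :: "real^'n^'n"
  assumes "\<And>i. i \<in> I \<Longrightarrow> A i ** T = T ** B i"
  shows "(\<Sum>i\<in>I. c i *\<^sub>R A i) ** T = T ** (\<Sum>i\<in>I. c i *\<^sub>R B i)"
  using assms
  by (induction I rule: infinite_finite_induct)
    (simp_all add: matrix_add_ldistrib matrix_add_rdistrib matrix_scalar_ac
      flip: scalar_matrix_assoc)

lemma sep_matrix_zeta:
  assumes "simple_graph E" "\<And>v. distribution01 (h v)"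
  shows "sep_matrix E \<eta> \<xi> h ** zeta_matrix = zeta_matrix ** sep_dual E \<eta> \<xi> h"
proof -
  have "internal_matrix E \<eta> ** zeta_matrix = zeta_matrix ** internal_matrix E \<eta>"
    unfolding internal_matrix_def
    by (rule matrix_sum_scaleR_intertwine) (metis exch_edge_obtain[OF assms(1)] exch_pair_zeta)
  moreover have "heat_bath_matrix \<xi> h ** zeta_matrix =
      zeta_matrix ** (\<Sum>v\<in>UNIV. \<xi> v *\<^sub>R bath_dual v (h v))"
    unfolding heat_bath_matrix_def
    by (intro matrix_sum_scaleR_intertwine bath_vertex_zeta assms)
  ultimately show ?thesis
    by (simp add: sep_matrix_def sep_dual_def matrix_add_ldistrib matrix_add_rdistrib)
qed

text \<open>Exchanges permute the sites and so preserve the number of particles.\<close>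

lemma internal_matrix_eq_0:
  assumes "simple_graph E" "card (Collect \<sigma>) \<noteq> card (Collect \<tau>)"
  shows "internal_matrix E \<eta> $ \<sigma> $ \<tau> = 0"
proof -
  have "exch_edge e $ \<sigma> $ \<tau> = 0" if e: "e \<in> E" for e
  proof -
    obtain u v where uv: "u \<noteq> v" "exch_edge e = exch_pair u v"
      using exch_edge_obtain[OF assms(1) e] .
    have "Collect (\<sigma> \<circ> Transposition.transpose u v) = Transposition.transpose u v -` Collect \<sigma>"
      by auto
    then have "card (Collect (\<sigma> \<circ> Transposition.transpose u v)) = card (Collect \<sigma>)"
      by (simp only:) (rule card_vimage_inj, simp_all add: surj_transpose)
    then show ?thesis
      using assms(2) uv by (auto simp: exch_pair_nth)
  qed
  then show ?thesis
    by (simp add: internal_matrix_def)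
qed

lemma Collect_remove: "Collect (\<tau>(v := False)) = Collect \<tau> - {v}"
  by (auto simp: fun_upd_def)

lemma bath_dual_eq_0:
  assumes "card (Collect \<rho>) > card (Collect \<tau>)"
  shows "bath_dual v p $ \<rho> $ \<tau> = 0"
proof -
  have "card (Collect (\<tau>(v := False))) \<le> card (Collect \<tau>)"
    by (rule card_mono) (auto simp: Collect_remove)
  then show ?thesis
    using assms by (auto simp: bath_dual_def)
qed

text \<open>The entries that carry \<open>p True\<close> have a row with one particle fewer than the
  column, so they lie strictly above the diagonal blocks.\<close>

lemma bath_dual_diagonal_block:
  assumes "card (Collect \<rho>) = card (Collect \<tau>)"
  shows "bath_dual v p $ \<rho> $ \<tau> = bath_dual v q $ \<rho> $ \<tau>"
proof -
  have "card (Collect (\<tau>(v := False))) < card (Collect \<tau>)" if "\<tau> v"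
    by (rule psubset_card_mono) (use that in \<open>auto simp: Collect_remove\<close>)
  then show ?thesis
    using assms by (auto simp: bath_dual_def)
qed

theorem theorem3:
  fixes E :: "'v::finite set set" and \<eta> :: "'v set \<Rightarrow> real" and \<xi> :: "'v \<Rightarrow> real"
    and h h' :: "'v \<Rightarrow> bool \<Rightarrow> real"
  assumes "simple_graph E" and "connected_graph E"
    and "\<And>e. e \<in> E \<Longrightarrow> \<eta> e > 0"
    and "\<And>v. \<xi> v \<ge> 0" and "(\<Sum>v\<in>UNIV. \<xi> v) > 0"
    and "\<And>v. distribution01 (h v)" and "\<And>v. distribution01 (h' v)"
  shows "spec (sep_matrix E \<eta> \<xi> h') = spec (sep_matrix E \<eta> \<xi> h)"
proof -
  have dual: "spec (sep_matrix E \<eta> \<xi> g) = spec (sep_dual E \<eta> \<xi> g)"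
    if "\<And>v. distribution01 (g v)" for g
    by (rule spec_similar[OF sep_matrix_zeta]) (simp_all add: assms(1) that det_zeta_matrix)
  have "spec (sep_dual E \<eta> \<xi> h') = spec (sep_dual E \<eta> \<xi> h)"
  \<comment> \<open>The grading is the particle number. Both dual matrices share the internal part,
    so only the bath terms have to be compared within a block.\<close>
  proof (rule spec_graded_triangular_cong[of "\<lambda>\<sigma>. card (Collect \<sigma>)"])
    fix \<sigma> \<tau> :: "'v \<Rightarrow> bool"
    assume "card (Collect \<sigma>) = card (Collect \<tau>)"
    then show "sep_dual E \<eta> \<xi> h' $ \<sigma> $ \<tau> = sep_dual E \<eta> \<xi> h $ \<sigma> $ \<tau>"
      by (simp add: sep_dual_def bath_dual_diagonal_block[of \<sigma> \<tau> _ "h' x" "h x" for x])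
  qed (simp_all add: sep_dual_def internal_matrix_eq_0[OF assms(1)] bath_dual_eq_0)
  then show ?thesis
    using dual assms(6,7) by simp
qed

end
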